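(* Let $X$ be a connected graph with basepoint $x_0$, and let $q\colon\overline{X}\to X$ be its maximal abelian cover. The homomorphism $\psi\colon\mathrm{Cov}(X)\to\mathrm{Aut}(X)$, sending each covering symmetry $g$ to the automorphism of $X$ that it covers, is onto, and its kernel is $H_1(X,\mathbb{Z})$ (acting on $\overline{X}$ as deck transformations), so there is a short exact sequence $$1\longrightarrow H_1(X,\mathbb{Z})\longrightarrow\mathrm{Cov}(X)\stackrel{\psi}{\longrightarrow}\mathrm{Aut}(X)\longrightarrow 1 .$$
   Context: Graphs. A graph $X=(E,V,s,t,\mathrm{inv})$ consists of a set $V$ of vertices, a set $E$ of edges, source and target maps $s,t\colon E\to V$, and a map $\mathrm{inv}\colon E\to E$, $e\mapsto e^{-1}$, with $s(e^{-1})=t(e)$, $t(e^{-1})=s(e)$, $(e^{-1})^{-1}=e$ and $e^{-1}\neq e$ for all $e$. Write $e\colon v\to w$ if $s(e)=v$, $t(e)=w$. A map of graphs is a pair of functions, on vertices and on edges, preserving source, target and inverse. An automorphism of $X$ is an invertible map of graphs $X\to X$; these form the group $\mathrm{Aut}(X)$. Paths. A path $\gamma\colon x\to y$ is a word of edges $\gamma=e_1\cdots e_\ell$ with $e_k\colon v_{k-1}\to v_k$, $v_0=x$, $v_\ell=y$; the empty word is allowed iff $x=y$ (trivial path). Paths are composed by concatenation. A loop based at $x$ is a path $x\to x$. Two paths are homologous if one can be obtained from the other by finitely many moves of the following types: introducing or deleting a subword $e e^{-1}$; replacing a subword $\lambda\mu$ by $\mu\lambda$, where $\lambda,\mu$ are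 loops based at the same vertex. $\llbracket\gamma\rrbracket$ denotes the homology class of $\gamma$. Maximal abelian cover. The vertices of $\overline{X}$, called atoms, are the homology classes $\llbracket\alpha\rrbracket\colon x_0\to x$ of paths starting at $x_0$. The edges of $\overline{X}$ are the pairs $(\llbracket\alpha\rrbracket\colon x_0\to x,\ e\colon x\to y)$, with source $\llbracket\alpha\rrbracket$, target $\llbracket\alpha e\rrbracket$ and inverse $(\llbracket\alpha e\rrbracket,e^{-1})$. The covering map $q$ sends $\llbracket\alpha\rrbracket\colon x_0\to x$ to $x$ and $(\llbracket\alpha\rrbracket,e)$ to $e$. The group of homology classes of loops based at $x_0$ under composition is the abelianization of $\pi_1(X)$ and is identified with $H_1(X,\mathbb{Z})$; an element $\llbracket\gamma\rrbracket$ of it acts on $\overline{X}$ as the deck transformation $\llbracket\delta\rrbracket\mapsto\llbracket\gamma\delta\rrbracket$, $(\llbracket\delta\rrbracket,e)\mapsto(\llbracket\gamma\delta\rrbracket,e)$. Covering symmetries. An automorphism $g$ of $\overline{X}$ covers an automorphism $f$ of $X$ if $q\circ g=f\circ q$. $\mathrm{Cov}(X)$ is the group of automorphisms of $\overline{X}$ that cover some automorphism of $X$; since $q$ is onto, each $g\in\mathrm{Cov}(X)$ covers exactly one $f\in\mathrm{Aut}(X)$, and $\psi(g)=f$ defines a group homomorphism. *)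

theory Defs
  imports "HOL-Algebra.Coset"
begin

record ('v, 'e) sgraph =
  verts :: "'v set"
  edges :: "'e set"
  src :: "'e \<Rightarrow> 'v"
  tgt :: "'e \<Rightarrow> 'v"
  einv :: "'e \<Rightarrow> 'e"

definition is_graph :: "('v, 'e) sgraph \<Rightarrow> bool" where
  "is_graph X \<longleftrightarrow> (\<forall>e \<in> edges X.
     src X e \<in> verts X \<and> tgt X e \<in> verts X \<and> einv X e \<in> edges X \<and>
     src X (einv X e) = tgt X e \<and> tgt X (einv X e) = src X e \<and>
     einv X (einv X e) = e \<and> einv X e \<noteq> e)"

text \<open>The two components of a map of graphs are extensional functions on vertices and edges,
  so that equality of maps is equality in the logic.\<close>

type_synonym ('v, 'e, 'w, 'd) gmap = "('v \<Rightarrow> 'w) \<times> ('e \<Rightarrow> 'd)"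

definition graph_maps ::
  "('v, 'e) sgraph \<Rightarrow> ('w, 'd) sgraph \<Rightarrow> ('v, 'e, 'w, 'd) gmap set" where
  "graph_maps X Y = {f. fst f \<in> verts X \<rightarrow>\<^sub>E verts Y \<and> snd f \<in> edges X \<rightarrow>\<^sub>E edges Y \<and>
     (\<forall>e \<in> edges X. src Y (snd f e) = fst f (src X e) \<and>
                    tgt Y (snd f e) = fst f (tgt X e) \<and>
                    einv Y (snd f e) = snd f (einv X e))}"

definition gcomp ::
  "('v, 'e) sgraph \<Rightarrow> ('w, 'd, 'u, 'c) gmap \<Rightarrow> ('v, 'e, 'w, 'd) gmap \<Rightarrow> ('v, 'e, 'u, 'c) gmap" where
  "gcomp X g f = (compose (verts X) (fst g) (fst f), compose (edges X) (snd g) (snd f))"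

definition gid :: "('v, 'e) sgraph \<Rightarrow> ('v, 'e, 'v, 'e) gmap" where
  "gid X = ((\<lambda>x \<in> verts X. x), (\<lambda>e \<in> edges X. e))"

definition automorphisms :: "('v, 'e) sgraph \<Rightarrow> ('v, 'e, 'v, 'e) gmap set" where
  "automorphisms X = {f \<in> graph_maps X X.
     \<exists>h \<in> graph_maps X X. gcomp X f h = gid X \<and> gcomp X h f = gid X}"

definition Aut :: "('v, 'e) sgraph \<Rightarrow> ('v, 'e, 'v, 'e) gmap monoid" where
  "Aut X = \<lparr>carrier = automorphisms X, monoid.mult = gcomp X, one = gid X\<rparr>"

text \<open>Both endpoints are stored with the word, which distinguishes the trivial paths at
  different vertices.\<close>

datatype ('v, 'e) path = Path (origin: 'v) (word: "'e list") (terminus: 'v)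

fun walk :: "('v, 'e) sgraph \<Rightarrow> 'v \<Rightarrow> 'e list \<Rightarrow> 'v \<Rightarrow> bool" where
  "walk X x [] y \<longleftrightarrow> x = y \<and> x \<in> verts X"
| "walk X x (e # es) y \<longleftrightarrow>
     x \<in> verts X \<and> e \<in> edges X \<and> src X e = x \<and> walk X (tgt X e) es y"

definition paths :: "('v, 'e) sgraph \<Rightarrow> ('v, 'e) path set" where
  "paths X = {\<gamma>. walk X (origin \<gamma>) (word \<gamma>) (terminus \<gamma>)}"

definition connected_graph :: "('v, 'e) sgraph \<Rightarrow> bool" where
  "connected_graph X \<longleftrightarrow> is_graph X \<and>
     (\<forall>x \<in> verts X. \<forall>y \<in> verts X. \<exists>\<gamma> \<in> paths X. origin \<gamma> = x \<and> terminus \<gamma> = y)"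

fun pcat :: "('v, 'e) path \<Rightarrow> ('v, 'e) path \<Rightarrow> ('v, 'e) path" where
  "pcat (Path x es y) (Path y' fs z) = Path x (es @ fs) z"

inductive move :: "('v, 'e) sgraph \<Rightarrow> ('v, 'e) path \<Rightarrow> ('v, 'e) path \<Rightarrow> bool" for X where
  introduce: "\<lbrakk>Path x (as @ bs) y \<in> paths X; Path x (as @ [e, einv X e] @ bs) y \<in> paths X\<rbrakk>
     \<Longrightarrow> move X (Path x (as @ bs) y) (Path x (as @ [e, einv X e] @ bs) y)"
| delete: "\<lbrakk>Path x (as @ bs) y \<in> paths X; Path x (as @ [e, einv X e] @ bs) y \<in> paths X\<rbrakk>
     \<Longrightarrow> move X (Path x (as @ [e, einv X e] @ bs) y) (Path x (as @ bs) y)"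
| swap: "\<lbrakk>Path x (as @ ls @ ms @ bs) y \<in> paths X; Path x (as @ ms @ ls @ bs) y \<in> paths X;
      Path v ls v \<in> paths X; Path v ms v \<in> paths X\<rbrakk>
     \<Longrightarrow> move X (Path x (as @ ls @ ms @ bs) y) (Path x (as @ ms @ ls @ bs) y)"

definition homologous :: "('v, 'e) sgraph \<Rightarrow> ('v, 'e) path \<Rightarrow> ('v, 'e) path \<Rightarrow> bool" where
  "homologous X \<alpha> \<beta> \<longleftrightarrow> \<alpha> \<in> paths X \<and> \<beta> \<in> paths X \<and> (move X)\<^sup>*\<^sup>* \<alpha> \<beta>"

definition hcls :: "('v, 'e) sgraph \<Rightarrow> ('v, 'e) path \<Rightarrow> ('v, 'e) path set" where
  "hcls X \<alpha> = {\<beta>. homologous X \<alpha> \<beta>}"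

text \<open>Composition of homology classes, by a union over representatives;
  \<open>hcomp_hcls\<close> below shows that it is well defined.\<close>

definition hcomp ::
  "('v, 'e) sgraph \<Rightarrow> ('v, 'e) path set \<Rightarrow> ('v, 'e) path set \<Rightarrow> ('v, 'e) path set" where
  "hcomp X A B = (\<Union>\<alpha> \<in> A. \<Union>\<beta> \<in> B. hcls X (pcat \<alpha> \<beta>))"

text \<open>The abelianization of the fundamental group at \<open>x0\<close>, identified with the first integral
  homology group when the graph is connected.\<close>

definition H1 :: "('v, 'e) sgraph \<Rightarrow> 'v \<Rightarrow> ('v, 'e) path set monoid" where
  "H1 X x0 = \<lparr>carrier = {hcls X \<gamma> |\<gamma>. \<gamma> \<in> paths X \<and> origin \<gamma> = x0 \<and> terminus \<gamma> = x0},
              monoid.mult = hcomp X, one = hcls X (Path x0 [] x0)\<rparr>"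

definition atoms :: "('v, 'e) sgraph \<Rightarrow> 'v \<Rightarrow> ('v, 'e) path set set" where
  "atoms X x0 = {hcls X \<alpha> |\<alpha>. \<alpha> \<in> paths X \<and> origin \<alpha> = x0}"

text \<open>The common terminal vertex of the paths in a homology class.\<close>

definition hterm :: "('v, 'e) path set \<Rightarrow> 'v" where
  "hterm A = the_elem (terminus ` A)"

definition extend ::
  "('v, 'e) sgraph \<Rightarrow> ('v, 'e) path set \<Rightarrow> 'e \<Rightarrow> ('v, 'e) path set" where
  "extend X A e = hcomp X A (hcls X (Path (src X e) [e] (tgt X e)))"

definition cover ::
  "('v, 'e) sgraph \<Rightarrow> 'v \<Rightarrow> (('v, 'e) path set, ('v, 'e) path set \<times> 'e) sgraph" where
  "cover X x0 =
     \<lparr>verts = atoms X x0,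
      edges = {(A, e). A \<in> atoms X x0 \<and> e \<in> edges X \<and> src X e = hterm A},
      src = (\<lambda>(A, e). A),
      tgt = (\<lambda>(A, e). extend X A e),
      einv = (\<lambda>(A, e). (extend X A e, einv X e))\<rparr>"

definition cover_map ::
  "('v, 'e) sgraph \<Rightarrow> 'v \<Rightarrow> (('v, 'e) path set, ('v, 'e) path set \<times> 'e, 'v, 'e) gmap" where
  "cover_map X x0 = ((\<lambda>A \<in> verts (cover X x0). hterm A), (\<lambda>p \<in> edges (cover X x0). snd p))"

type_synonym ('v, 'e) cover_automorphism =
  "(('v, 'e) path set, ('v, 'e) path set \<times> 'e, ('v, 'e) path set, ('v, 'e) path set \<times> 'e) gmap"

definition covers ::
  "('v, 'e) sgraph \<Rightarrow> 'v \<Rightarrow> ('v, 'e) cover_automorphism \<Rightarrow> ('v, 'e, 'v, 'e) gmap \<Rightarrow> bool" where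
  "covers X x0 g f \<longleftrightarrow>
     gcomp (cover X x0) (cover_map X x0) g = gcomp (cover X x0) f (cover_map X x0)"

definition Cov :: "('v, 'e) sgraph \<Rightarrow> 'v \<Rightarrow> ('v, 'e) cover_automorphism monoid" where
  "Cov X x0 = Aut (cover X x0)
     \<lparr>carrier := {g \<in> automorphisms (cover X x0). \<exists>f \<in> automorphisms X. covers X x0 g f}\<rparr>"

text \<open>The description is proper by \<open>covers_unique\<close> below.\<close>

definition \<psi> :: "('v, 'e) sgraph \<Rightarrow> 'v \<Rightarrow> ('v, 'e) cover_automorphism \<Rightarrow> ('v, 'e, 'v, 'e) gmap" where
  "\<psi> X x0 g = (THE f. f \<in> automorphisms X \<and> covers X x0 g f)"

definition deck ::
  "('v, 'e) sgraph \<Rightarrow> 'v \<Rightarrow> ('v, 'e) path set \<Rightarrow> ('v, 'e) cover_automorphism" where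
  "deck X x0 C = ((\<lambda>D \<in> verts (cover X x0). hcomp X C D),
                  (\<lambda>(D, e) \<in> edges (cover X x0). (hcomp X C D, e)))"

lemma walk_append: "walk X x (es @ fs) z \<longleftrightarrow> (\<exists>y. walk X x es y \<and> walk X y fs z)"
proof (induction es arbitrary: x)
  case Nil
  have "walk X x fs z \<Longrightarrow> x \<in> verts X" by (cases fs) auto
  then show ?case by auto
qed auto

lemma walk_ends: "walk X x es y \<Longrightarrow> x \<in> verts X \<and> y \<in> verts X"
  by (induction es arbitrary: x) auto

lemma pcat_paths:
  "\<lbrakk>\<alpha> \<in> paths X; \<beta> \<in> paths X; terminus \<alpha> = origin \<beta>\<rbrakk> \<Longrightarrow> pcat \<alpha> \<beta> \<in> paths X"
  by (cases \<alpha>; cases \<beta>) (auto simp: paths_def walk_append)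

lemma pcat_sel [simp]:
  "origin (pcat \<alpha> \<beta>) = origin \<alpha>" "terminus (pcat \<alpha> \<beta>) = terminus \<beta>"
  "word (pcat \<alpha> \<beta>) = word \<alpha> @ word \<beta>"
  by (cases \<alpha>; cases \<beta>; simp)+

lemma move_paths: "move X \<alpha> \<beta> \<Longrightarrow> \<alpha> \<in> paths X \<and> \<beta> \<in> paths X"
  by (induction rule: move.induct) auto

lemma move_ends: "move X \<alpha> \<beta> \<Longrightarrow> origin \<beta> = origin \<alpha> \<and> terminus \<beta> = terminus \<alpha>"
  by (induction rule: move.induct) auto

lemma move_sym: "move X \<alpha> \<beta> \<Longrightarrow> move X \<beta> \<alpha>"
  by (induction rule: move.induct) (rule move.intros; assumption)+

lemma homologous_refl: "\<alpha> \<in> paths X \<Longrightarrow> homologous X \<alpha> \<alpha>"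
  by (simp add: homologous_def)

lemma homologous_sym: "homologous X \<alpha> \<beta> \<Longrightarrow> homologous X \<beta> \<alpha>"
  unfolding homologous_def by (metis (no_types) move_sym symp_rtranclp sympD sympI)

lemma homologous_trans: "homologous X \<alpha> \<beta> \<Longrightarrow> homologous X \<beta> \<gamma> \<Longrightarrow> homologous X \<alpha> \<gamma>"
  unfolding homologous_def by auto

lemma homologous_ends:
  assumes "homologous X \<alpha> \<beta>" shows "origin \<beta> = origin \<alpha>" "terminus \<beta> = terminus \<alpha>"
proof -
  have "(move X)\<^sup>*\<^sup>* \<alpha> \<beta>" using assms by (simp add: homologous_def)
  then have "origin \<beta> = origin \<alpha> \<and> terminus \<beta> = terminus \<alpha>"
    by induction (auto dest: move_ends)
  then show "origin \<beta> = origin \<alpha>" "terminus \<beta> = terminus \<alpha>" by auto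
qed

lemma hcls_eq_iff: "\<alpha> \<in> paths X \<Longrightarrow> \<beta> \<in> paths X \<Longrightarrow> hcls X \<alpha> = hcls X \<beta> \<longleftrightarrow> homologous X \<alpha> \<beta>"
  unfolding hcls_def set_eq_iff mem_Collect_eq
  using homologous_refl homologous_sym homologous_trans by metis

lemma move_pcat_right:
  assumes "move X \<alpha> \<alpha>'" "\<beta> \<in> paths X" "terminus \<alpha> = origin \<beta>"
  shows "move X (pcat \<alpha> \<beta>) (pcat \<alpha>' \<beta>)"
proof -
  obtain u fs z where \<beta>: "\<beta> = Path u fs z" by (cases \<beta>)
  have P: "pcat \<alpha> \<beta> \<in> paths X" "pcat \<alpha>' \<beta> \<in> paths X"
    using assms move_paths[OF assms(1)] move_ends[OF assms(1)] by (auto intro: pcat_paths)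
  from assms(1) P show ?thesis
  proof cases
    case (introduce x as bs y e)
    then show ?thesis using P move.introduce[of x as "bs @ fs" z X e] by (simp add: \<beta>)
  next
    case (delete x as bs y e)
    then show ?thesis using P move.delete[of x as "bs @ fs" z X e] by (simp add: \<beta>)
  next
    case (swap x as ls ms bs y v)
    then show ?thesis using P move.swap[of x as ls ms "bs @ fs" z X v] by (simp add: \<beta>)
  qed
qed

lemma move_pcat_left:
  assumes "move X \<beta> \<beta>'" "\<alpha> \<in> paths X" "terminus \<alpha> = origin \<beta>"
  shows "move X (pcat \<alpha> \<beta>) (pcat \<alpha> \<beta>')"
proof -
  obtain u fs z where \<alpha>: "\<alpha> = Path u fs z" by (cases \<alpha>)
  have P: "pcat \<alpha> \<beta> \<in> paths X" "pcat \<alpha> \<beta>' \<in> paths X"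
    using assms move_paths[OF assms(1)] move_ends[OF assms(1)] by (auto intro: pcat_paths)
  from assms(1) P show ?thesis
  proof cases
    case (introduce x as bs y e)
    then show ?thesis using P move.introduce[of u "fs @ as" bs y X e] by (simp add: \<alpha>)
  next
    case (delete x as bs y e)
    then show ?thesis using P move.delete[of u "fs @ as" bs y X e] by (simp add: \<alpha>)
  next
    case (swap x as ls ms bs y v)
    then show ?thesis using P move.swap[of u "fs @ as" ls ms bs y X v] by (simp add: \<alpha>)
  qed
qed

lemma homologous_pcat:
  assumes "homologous X \<alpha> \<alpha>'" "homologous X \<beta> \<beta>'" "terminus \<alpha> = origin \<beta>"
  shows "homologous X (pcat \<alpha> \<beta>) (pcat \<alpha>' \<beta>')"
proof -
  have a: "\<alpha> \<in> paths X" "\<alpha>' \<in> paths X" "(move X)\<^sup>*\<^sup>* \<alpha> \<alpha>'"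
    and b: "\<beta> \<in> paths X" "\<beta>' \<in> paths X" "(move X)\<^sup>*\<^sup>* \<beta> \<beta>'"
    using assms by (auto simp: homologous_def)
  have "(move X)\<^sup>*\<^sup>* (pcat \<alpha> \<beta>) (pcat \<alpha>' \<beta>) \<and> terminus \<alpha>' = terminus \<alpha>"
    using a(3)
  proof induction
    case (step \<gamma> \<gamma>')
    then have "move X (pcat \<gamma> \<beta>) (pcat \<gamma>' \<beta>)" "terminus \<gamma>' = terminus \<gamma>"
      using move_pcat_right b(1) assms(3) move_ends by metis+
    then show ?case using step by auto
  qed simp
  moreover have "(move X)\<^sup>*\<^sup>* (pcat \<alpha>' \<beta>) (pcat \<alpha>' \<beta>') \<and> origin \<beta>' = origin \<beta>"
    if "terminus \<alpha>' = origin \<beta>"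
    using b(3)
  proof induction
    case (step \<gamma> \<gamma>')
    then have "move X (pcat \<alpha>' \<gamma>) (pcat \<alpha>' \<gamma>')" "origin \<gamma>' = origin \<gamma>"
      using move_pcat_left a(2) that move_ends by metis+
    then show ?case using step by auto
  qed simp
  ultimately show ?thesis
    unfolding homologous_def using a b assms(3) pcat_paths by (metis rtranclp_trans)
qed

lemma hcomp_hcls:
  assumes "\<alpha> \<in> paths X" "\<beta> \<in> paths X" "terminus \<alpha> = origin \<beta>"
  shows "hcomp X (hcls X \<alpha>) (hcls X \<beta>) = hcls X (pcat \<alpha> \<beta>)"
proof -
  have "hcls X (pcat \<alpha>' \<beta>') = hcls X (pcat \<alpha> \<beta>)" if "\<alpha>' \<in> hcls X \<alpha>" "\<beta>' \<in> hcls X \<beta>" for \<alpha>' \<beta>'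
  proof -
    have h: "homologous X (pcat \<alpha> \<beta>) (pcat \<alpha>' \<beta>')"
      using that assms homologous_pcat by (auto simp: hcls_def)
    then show ?thesis by (metis hcls_eq_iff homologous_def)
  qed
  moreover have "\<alpha> \<in> hcls X \<alpha>" "\<beta> \<in> hcls X \<beta>"
    using assms homologous_refl by (auto simp: hcls_def)
  ultimately show ?thesis unfolding hcomp_def by blast
qed

lemma hterm_hcls: "\<alpha> \<in> paths X \<Longrightarrow> hterm (hcls X \<alpha>) = terminus \<alpha>"
proof -
  assume "\<alpha> \<in> paths X"
  then have "terminus ` hcls X \<alpha> = {terminus \<alpha>}"
    using homologous_refl homologous_ends(2) by (force simp: hcls_def)
  then show ?thesis by (simp add: hterm_def)
qed

lemma extend_hcls:
  assumes "is_graph X" "Path x es y \<in> paths X" "e \<in> edges X" "src X e = y"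
  shows "extend X (hcls X (Path x es y)) e = hcls X (Path x (es @ [e]) (tgt X e))"
    and "Path x (es @ [e]) (tgt X e) \<in> paths X"
proof -
  have e: "Path (src X e) [e] (tgt X e) \<in> paths X"
    using assms by (auto simp: paths_def is_graph_def)
  show "extend X (hcls X (Path x es y)) e = hcls X (Path x (es @ [e]) (tgt X e))"
    using hcomp_hcls[OF assms(2) e] assms(4) by (simp add: extend_def)
  show "Path x (es @ [e]) (tgt X e) \<in> paths X"
    using pcat_paths[OF assms(2) e] assms(4) by simp
qed

lemma cover_edgeE:
  assumes "is_graph X" "p \<in> edges (cover X x0)"
  obtains es e where "p = (hcls X (Path x0 es (src X e)), e)" "e \<in> edges X"
    "Path x0 es (src X e) \<in> paths X" "Path x0 (es @ [e]) (tgt X e) \<in> paths X"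
    "extend X (fst p) e = hcls X (Path x0 (es @ [e]) (tgt X e))"
proof -
  obtain A e where p: "p = (A, e)" by (cases p)
  then have e: "e \<in> edges X" "A \<in> atoms X x0" "src X e = hterm A"
    using assms(2) by (auto simp: cover_def)
  then obtain \<alpha> where \<alpha>: "A = hcls X \<alpha>" "\<alpha> \<in> paths X" "origin \<alpha> = x0" by (auto simp: atoms_def)
  then have "terminus \<alpha> = src X e" using e hterm_hcls[of \<alpha> X] by simp
  then have w: "\<alpha> = Path x0 (word \<alpha>) (src X e)" using \<alpha>(3) by (cases \<alpha>) auto
  have P: "Path x0 (word \<alpha>) (src X e) \<in> paths X" using \<alpha>(2) w by simp
  show ?thesis
  proof (rule that[of "word \<alpha>" e])
    show "p = (hcls X (Path x0 (word \<alpha>) (src X e)), e)" using p \<alpha>(1) w by simp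
    then show "extend X (fst p) e = hcls X (Path x0 (word \<alpha> @ [e]) (tgt X e))"
      using extend_hcls(1)[OF assms(1) P e(1) refl] by simp
  qed (use e(1) P extend_hcls(2)[OF assms(1) P e(1) refl] in auto)
qed

lemma is_graph_cover:
  assumes "is_graph X"
  shows "is_graph (cover X x0)"
  unfolding is_graph_def
proof
  fix p assume p: "p \<in> edges (cover X x0)"
  obtain es e where q: "p = (hcls X (Path x0 es (src X e)), e)" "e \<in> edges X"
    "Path x0 es (src X e) \<in> paths X" "Path x0 (es @ [e]) (tgt X e) \<in> paths X"
    "extend X (fst p) e = hcls X (Path x0 (es @ [e]) (tgt X e))"
    using cover_edgeE[OF assms p] by blast
  have i: "einv X e \<in> edges X" "src X (einv X e) = tgt X e" "tgt X (einv X e) = src X e"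
    "einv X (einv X e) = e" "einv X e \<noteq> e"
    using assms q(2) by (auto simp: is_graph_def)
  have x: "extend X (hcls X (Path x0 (es @ [e]) (tgt X e))) (einv X e)
             = hcls X (Path x0 (es @ [e, einv X e]) (src X e))"
    "Path x0 (es @ [e, einv X e]) (src X e) \<in> paths X"
    using extend_hcls[OF assms q(4) i(1,2)] i(3) by auto
  have "move X (Path x0 (es @ [e, einv X e]) (src X e)) (Path x0 es (src X e))"
    using move.delete[of x0 es "[]" "src X e" X e] q(3) x(2) by simp
  then have y: "hcls X (Path x0 (es @ [e, einv X e]) (src X e)) = hcls X (Path x0 es (src X e))"
    using hcls_eq_iff[OF x(2) q(3)] x(2) q(3) by (auto simp: homologous_def)
  have "hcls X (Path x0 es (src X e)) \<in> atoms X x0"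
       "hcls X (Path x0 (es @ [e]) (tgt X e)) \<in> atoms X x0"
    using q by (force simp: atoms_def)+
  then show "src (cover X x0) p \<in> verts (cover X x0) \<and> tgt (cover X x0) p \<in> verts (cover X x0) \<and>
     einv (cover X x0) p \<in> edges (cover X x0) \<and>
     src (cover X x0) (einv (cover X x0) p) = tgt (cover X x0) p \<and>
     tgt (cover X x0) (einv (cover X x0) p) = src (cover X x0) p \<and>
     einv (cover X x0) (einv (cover X x0) p) = p \<and> einv (cover X x0) p \<noteq> p"
    using q i x y hterm_hcls[OF q(4)] by (simp add: cover_def)
qed

lemma cover_map_graph_map:
  assumes "is_graph X"
  shows "cover_map X x0 \<in> graph_maps (cover X x0) X"
proof -
  have v: "hterm A \<in> verts X" if A: "A \<in> verts (cover X x0)" for A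
  proof -
    obtain \<alpha> where "A = hcls X \<alpha>" "\<alpha> \<in> paths X" using A by (auto simp: cover_def atoms_def)
    then show ?thesis using hterm_hcls[of \<alpha> X] walk_ends[of X] by (metis mem_Collect_eq paths_def)
  qed
  have e: "snd p \<in> edges X" "src X (snd p) = hterm (src (cover X x0) p)"
          "tgt X (snd p) = hterm (tgt (cover X x0) p)"
          "einv X (snd p) = snd (einv (cover X x0) p)" if p: "p \<in> edges (cover X x0)" for p
  proof -
    obtain es e where q: "p = (hcls X (Path x0 es (src X e)), e)" "e \<in> edges X"
      "Path x0 es (src X e) \<in> paths X" "Path x0 (es @ [e]) (tgt X e) \<in> paths X"
      "extend X (fst p) e = hcls X (Path x0 (es @ [e]) (tgt X e))"
      using cover_edgeE[OF assms p] by blast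
    show "snd p \<in> edges X" "src X (snd p) = hterm (src (cover X x0) p)"
         "tgt X (snd p) = hterm (tgt (cover X x0) p)"
         "einv X (snd p) = snd (einv (cover X x0) p)"
      using q(2,5) hterm_hcls[OF q(3)] hterm_hcls[OF q(4)] by (simp_all add: q(1) cover_def)
  qed
  have c: "src (cover X x0) p \<in> verts (cover X x0)" "tgt (cover X x0) p \<in> verts (cover X x0)"
          "einv (cover X x0) p \<in> edges (cover X x0)" if "p \<in> edges (cover X x0)" for p
    using is_graph_cover[OF assms, of x0] that by (simp_all add: is_graph_def)
  show ?thesis
    unfolding graph_maps_def cover_map_def
    by (simp add: v e c PiE_iff extensional_def)
qed

lemma cover_map_onto:
  assumes "connected_graph X" "x0 \<in> verts X"
  shows "fst (cover_map X x0) ` verts (cover X x0) = verts X"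
    and "snd (cover_map X x0) ` edges (cover X x0) = edges X"
proof -
  have g: "is_graph X" using assms by (simp add: connected_graph_def)
  have lift: "\<exists>A \<in> atoms X x0. hterm A = x" if x: "x \<in> verts X" for x
  proof -
    obtain \<gamma> where "\<gamma> \<in> paths X" "origin \<gamma> = x0" "terminus \<gamma> = x"
      using assms x by (auto simp: connected_graph_def)
    then show ?thesis using hterm_hcls by (force simp: atoms_def)
  qed
  show "fst (cover_map X x0) ` verts (cover X x0) = verts X"
  proof
    show "fst (cover_map X x0) ` verts (cover X x0) \<subseteq> verts X"
      using cover_map_graph_map[OF g, of x0] by (auto simp: graph_maps_def)
    show "verts X \<subseteq> fst (cover_map X x0) ` verts (cover X x0)"
      using lift by (force simp: cover_map_def cover_def)
  qed
  show "snd (cover_map X x0) ` edges (cover X x0) = edges X"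
  proof
    show "snd (cover_map X x0) ` edges (cover X x0) \<subseteq> edges X"
      using cover_map_graph_map[OF g, of x0] by (auto simp: graph_maps_def)
    show "edges X \<subseteq> snd (cover_map X x0) ` edges (cover X x0)"
    proof
      fix e assume e: "e \<in> edges X"
      then obtain A where "A \<in> atoms X x0" "src X e = hterm A"
        using lift g by (metis is_graph_def)
      then have "(A, e) \<in> edges (cover X x0)" using e by (simp add: cover_def)
      then show "e \<in> snd (cover_map X x0) ` edges (cover X x0)"
        by (force simp: cover_map_def)
    qed
  qed
qed

lemma covers_unique:
  assumes "connected_graph X" "x0 \<in> verts X" "g \<in> carrier (Cov X x0)"
  shows "\<exists>!f. f \<in> automorphisms X \<and> covers X x0 g f"
proof -
  have "f = f'" if f: "f \<in> automorphisms X" "covers X x0 g f"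
    and f': "f' \<in> automorphisms X" "covers X x0 g f'" for f f'
  proof -
    have eq: "gcomp (cover X x0) f (cover_map X x0) = gcomp (cover X x0) f' (cover_map X x0)"
      using f f' by (simp add: covers_def)
    have "fst f x = fst f' x" if "x \<in> verts X" for x
    proof -
      obtain A where A: "A \<in> verts (cover X x0)" "x = fst (cover_map X x0) A"
        using cover_map_onto(1)[OF assms(1,2)] \<open>x \<in> verts X\<close> by blast
      then show ?thesis
        using arg_cong[OF eq, of "\<lambda>h. fst h A"] by (simp add: gcomp_def compose_def)
    qed
    moreover have "snd f e = snd f' e" if "e \<in> edges X" for e
    proof -
      obtain p where p: "p \<in> edges (cover X x0)" "e = snd (cover_map X x0) p"
        using cover_map_onto(2)[OF assms(1,2)] \<open>e \<in> edges X\<close> by blast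
      then show ?thesis
        using arg_cong[OF eq, of "\<lambda>h. snd h p"] by (simp add: gcomp_def compose_def)
    qed
    moreover have "fst f \<in> verts X \<rightarrow>\<^sub>E verts X" "fst f' \<in> verts X \<rightarrow>\<^sub>E verts X"
      "snd f \<in> edges X \<rightarrow>\<^sub>E edges X" "snd f' \<in> edges X \<rightarrow>\<^sub>E edges X"
      using f(1) f'(1) by (simp_all add: automorphisms_def graph_maps_def)
    ultimately have "fst f = fst f'" "snd f = snd f'"
      by (meson PiE_ext)+
    then show ?thesis by (simp add: prod_eq_iff)
  qed
  then show ?thesis using assms(3) by (auto simp: Cov_def)
qed

end

theory Submission
  imports Defs
begin

text \<open>
  Everything rests on one construction. A graph map \<open>f\<close> of \<open>X\<close> sends paths to paths and respects
  the moves generating homology, so it acts on homology classes, \<open>A \<mapsto> f\<^sub>* A\<close> (\<open>hpush\<close>). It moves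
  the basepoint, however, so \<open>f\<^sub>* A\<close> is in general not an atom. Precomposing with an atom \<open>B\<close> that
  ends at \<open>f x\<^sub>0\<close> repairs this, and
  \<open>A \<mapsto> B \<cdot> f\<^sub>* A\<close>, \<open>(A, e) \<mapsto> (B \<cdot> f\<^sub>* A, f e)\<close>
  is a map \<open>lift f B\<close> of the cover that covers \<open>f\<close>. Three facts about lifts carry the proof.

  \<^item> Lifts compose like a semidirect product (\<open>lift_gcomp\<close>):
    \<open>lift f B \<circ> lift f' B' = lift (f \<circ> f') (B \<cdot> f\<^sub>* B')\<close>.
    Consequently a lift of an automorphism \<open>f\<close> is invertible (\<open>lift_automorphism\<close>): if \<open>h\<close> is
    inverse to \<open>f\<close> and \<open>B\<inverse>\<close> is the class of the reversed path, then \<open>lift h (h\<^sub>* B\<inverse>)\<close> is the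
    inverse.
  \<^item> Every map of the cover that covers \<open>f\<close> is a lift of \<open>f\<close> (\<open>covers_is_lift\<close>), namely with \<open>B\<close>
    the image of the trivial atom: an edge path in \<open>X\<close> starting at \<open>x\<^sub>0\<close> lifts uniquely once the
    image of its start is known.
  \<^item> Deck transformations are the lifts of the identity (\<open>lift_gid\<close>).

  Connectedness of \<open>X\<close> provides a path from \<open>x\<^sub>0\<close> to \<open>f x\<^sub>0\<close>, hence a lift of each automorphism \<open>f\<close>,
  so \<open>\<psi>\<close> is onto. An element of the kernel covers the identity, so it is a lift of the identity
  along a class \<open>B\<close> ending at \<open>x\<^sub>0\<close>, that is, the deck transformation of a loop class. That
  \<open>deck\<close> is a homomorphism is the composition law at \<open>f = f' = id\<close>, and it is injective because
  a deck transformation returns its class when applied to the trivial atom.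
\<close>

section \<open>Path and class algebra\<close>

lemma walk_edges: "walk X x es y \<Longrightarrow> set es \<subseteq> edges X"
  by (induction es arbitrary: x) auto

lemma trivial_path: "x \<in> verts X \<Longrightarrow> Path x [] x \<in> paths X"
  by (simp add: paths_def)

lemma pcat_assoc: "pcat (pcat \<alpha> \<beta>) \<gamma> = pcat \<alpha> (pcat \<beta> \<gamma>)"
  by (rule path.expand) simp

lemma pcat_trivial [simp]:
  "x = origin \<alpha> \<Longrightarrow> pcat (Path x [] z) \<alpha> = \<alpha>"
  "x = terminus \<alpha> \<Longrightarrow> pcat \<alpha> (Path z [] x) = \<alpha>"
  by (cases \<alpha>; simp)+

lemma homologous_of_move: "move X \<alpha> \<beta> \<Longrightarrow> homologous X \<alpha> \<beta>"
  using move_paths by (auto simp: homologous_def)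

lemma hcls_eqI: "homologous X \<alpha> \<beta> \<Longrightarrow> hcls X \<alpha> = hcls X \<beta>"
  by (metis hcls_eq_iff homologous_def)

lemma atomE:
  assumes "A \<in> atoms X x0"
  obtains \<alpha> where "A = hcls X \<alpha>" "\<alpha> \<in> paths X" "origin \<alpha> = x0" "hterm A = terminus \<alpha>"
  using assms by (auto simp: atoms_def hterm_hcls)

lemma hcls_atom: "\<alpha> \<in> paths X \<Longrightarrow> origin \<alpha> = x0 \<Longrightarrow> hcls X \<alpha> \<in> atoms X x0"
  by (auto simp: atoms_def)

definition preverse :: "('v, 'e) sgraph \<Rightarrow> ('v, 'e) path \<Rightarrow> ('v, 'e) path" where
  "preverse X \<alpha> = Path (terminus \<alpha>) (rev (map (einv X) (word \<alpha>))) (origin \<alpha>)"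

lemma preverse_sel [simp]:
  "origin (preverse X \<alpha>) = terminus \<alpha>" "terminus (preverse X \<alpha>) = origin \<alpha>"
  by (simp_all add: preverse_def)

lemma preverse_paths:
  assumes "is_graph X" "\<alpha> \<in> paths X"
  shows "preverse X \<alpha> \<in> paths X"
proof -
  have "walk X y (rev (map (einv X) es)) x" if "walk X x es y" for x es y
    using that
  proof (induction es arbitrary: x)
    case (Cons e es)
    then have "walk X y (rev (map (einv X) es)) (tgt X e)" by simp
    moreover have "walk X (tgt X e) [einv X e] x"
      using Cons.prems assms(1) by (auto simp: is_graph_def)
    ultimately show ?case by (auto simp: walk_append)
  qed simp
  then show ?thesis using assms(2) by (simp add: paths_def preverse_def)
qed

lemma preverse_preverse:
  assumes "is_graph X" "\<alpha> \<in> paths X"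
  shows "preverse X (preverse X \<alpha>) = \<alpha>"
proof -
  have "set (word \<alpha>) \<subseteq> edges X"
    using assms(2) walk_edges[of X "origin \<alpha>" "word \<alpha>" "terminus \<alpha>"] by (simp add: paths_def)
  then have "map (einv X \<circ> einv X) (word \<alpha>) = word \<alpha>"
    using assms(1) by (intro map_idI) (auto simp: is_graph_def)
  then show ?thesis by (intro path.expand) (simp add: preverse_def rev_map)
qed

text \<open>A path followed by its reverse contains \<open>e e\<inverse>\<close> at the turning point; deleting it leaves a
  shorter path followed by its reverse.\<close>

lemma pcat_preverse:
  assumes "is_graph X" "\<alpha> \<in> paths X"
  shows "homologous X (pcat \<alpha> (preverse X \<alpha>)) (Path (origin \<alpha>) [] (origin \<alpha>))"
proof -
  have "homologous X (Path x (es @ rev (map (einv X) es)) x) (Path x [] x)"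
    if "walk X x es y" for x es y
    using that
  proof (induction es arbitrary: y rule: rev_induct)
    case Nil
    then show ?case by (auto intro: homologous_refl trivial_path)
  next
    case (snoc e es)
    then have w: "walk X x es (src X e)" by (auto simp: walk_append)
    have P: "Path x (es' @ rev (map (einv X) es')) x \<in> paths X" if "walk X x es' z" for es' z
      using pcat_paths[of "Path x es' z" X "preverse X (Path x es' z)"]
        preverse_paths[OF assms(1), of "Path x es' z"] that
      by (simp add: paths_def preverse_def)
    have "move X (Path x (es @ [e, einv X e] @ rev (map (einv X) es)) x)
                 (Path x (es @ rev (map (einv X) es)) x)"
      using P[OF w] P[OF snoc.prems] by (intro move.delete) simp_all
    then show ?case
      using homologous_of_move homologous_trans snoc.IH[OF w] by fastforce
  qed
  from this[of "origin \<alpha>" "word \<alpha>" "terminus \<alpha>"] show ?thesis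
    using assms(2) by (cases \<alpha>) (simp add: paths_def preverse_def)
qed

lemma preverse_pcat:
  assumes "is_graph X" "\<alpha> \<in> paths X"
  shows "homologous X (pcat (preverse X \<alpha>) \<alpha>) (Path (terminus \<alpha>) [] (terminus \<alpha>))"
  using pcat_preverse[OF assms(1) preverse_paths[OF assms]] preverse_preverse[OF assms] by simp

text \<open>Composition of classes of loops is inherited from concatenation, and a reversed loop
  represents the inverse.\<close>

lemma group_H1:
  assumes "is_graph X" "x0 \<in> verts X"
  shows "group (H1 X x0)"
proof (rule groupI; (unfold H1_def)?; simp)
  fix A B C :: "('a, 'b) path set"
  assume "\<exists>\<gamma>. A = hcls X \<gamma> \<and> \<gamma> \<in> paths X \<and> origin \<gamma> = x0 \<and> terminus \<gamma> = x0"
  then obtain \<alpha> where \<alpha>: "A = hcls X \<alpha>" "\<alpha> \<in> paths X" "origin \<alpha> = x0" "terminus \<alpha> = x0" by blast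
  show "hcomp X (hcls X (Path x0 [] x0)) A = A"
    using \<alpha> assms by (simp add: hcomp_hcls trivial_path)
  show "\<exists>x. (\<exists>\<gamma>. x = hcls X \<gamma> \<and> \<gamma> \<in> paths X \<and> origin \<gamma> = x0 \<and> terminus \<gamma> = x0) \<and>
             hcomp X x A = hcls X (Path x0 [] x0)"
  proof (intro exI[of _ "hcls X (preverse X \<alpha>)"] conjI exI[of _ "preverse X \<alpha>"])
    show "hcomp X (hcls X (preverse X \<alpha>)) A = hcls X (Path x0 [] x0)"
      using \<alpha> assms preverse_pcat[of X \<alpha>]
      by (simp add: hcomp_hcls preverse_paths hcls_eqI)
  qed (use \<alpha> assms in \<open>simp_all add: preverse_paths\<close>)
  assume "\<exists>\<gamma>. B = hcls X \<gamma> \<and> \<gamma> \<in> paths X \<and> origin \<gamma> = x0 \<and> terminus \<gamma> = x0"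
  then obtain \<beta> where \<beta>: "B = hcls X \<beta>" "\<beta> \<in> paths X" "origin \<beta> = x0" "terminus \<beta> = x0" by blast
  show "\<exists>\<gamma>. hcomp X A B = hcls X \<gamma> \<and> \<gamma> \<in> paths X \<and> origin \<gamma> = x0 \<and> terminus \<gamma> = x0"
    using \<alpha> \<beta> by (intro exI[of _ "pcat \<alpha> \<beta>"]) (simp add: hcomp_hcls pcat_paths)
  assume "\<exists>\<gamma>. C = hcls X \<gamma> \<and> \<gamma> \<in> paths X \<and> origin \<gamma> = x0 \<and> terminus \<gamma> = x0"
  then obtain \<gamma> where \<gamma>: "C = hcls X \<gamma>" "\<gamma> \<in> paths X" "origin \<gamma> = x0" "terminus \<gamma> = x0" by blast
  show "hcomp X (hcomp X A B) C = hcomp X A (hcomp X B C)"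
    using \<alpha> \<beta> \<gamma> by (simp add: hcomp_hcls pcat_paths pcat_assoc)
next
  show "\<exists>\<gamma>. hcls X (Path x0 [] x0) = hcls X \<gamma> \<and> \<gamma> \<in> paths X \<and> origin \<gamma> = x0 \<and> terminus \<gamma> = x0"
    using trivial_path[OF assms(2)] by force
qed

section \<open>Graph maps and automorphism groups\<close>

lemma graph_mapD:
  assumes "f \<in> graph_maps X Y"
  shows "x \<in> verts X \<Longrightarrow> fst f x \<in> verts Y" "e \<in> edges X \<Longrightarrow> snd f e \<in> edges Y"
    "e \<in> edges X \<Longrightarrow> src Y (snd f e) = fst f (src X e)"
    "e \<in> edges X \<Longrightarrow> tgt Y (snd f e) = fst f (tgt X e)"
    "e \<in> edges X \<Longrightarrow> einv Y (snd f e) = snd f (einv X e)"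
  using assms by (auto simp: graph_maps_def)

lemma graph_map_eqI:
  assumes "f \<in> graph_maps X Y" "g \<in> graph_maps X Y"
    and "\<And>x. x \<in> verts X \<Longrightarrow> fst f x = fst g x" "\<And>e. e \<in> edges X \<Longrightarrow> snd f e = snd g e"
  shows "f = g"
proof (rule prod_eqI)
  show "fst f = fst g"
    using assms by (intro PiE_ext[of _ "verts X" "\<lambda>_. verts Y"]) (auto simp: graph_maps_def)
  show "snd f = snd g"
    using assms by (intro PiE_ext[of _ "edges X" "\<lambda>_. edges Y"]) (auto simp: graph_maps_def)
qed

lemma gcomp_apply [simp]:
  "x \<in> verts X \<Longrightarrow> fst (gcomp X g f) x = fst g (fst f x)"
  "e \<in> edges X \<Longrightarrow> snd (gcomp X g f) e = snd g (snd f e)"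
  by (simp_all add: gcomp_def compose_def)

lemma gid_apply [simp]:
  "x \<in> verts X \<Longrightarrow> fst (gid X) x = x" "e \<in> edges X \<Longrightarrow> snd (gid X) e = e"
  by (simp_all add: gid_def)

lemma gid_graph_map: "is_graph X \<Longrightarrow> gid X \<in> graph_maps X X"
  by (auto simp: graph_maps_def gid_def is_graph_def)

lemma gcomp_graph_map:
  assumes "is_graph X" "f \<in> graph_maps X Y" "g \<in> graph_maps Y Z"
  shows "gcomp X g f \<in> graph_maps X Z"
  using assms graph_mapD[OF assms(2)] graph_mapD[OF assms(3)]
  by (auto simp: graph_maps_def gcomp_def compose_def is_graph_def)

lemma gcomp_assoc:
  "f \<in> graph_maps X Y \<Longrightarrow> gcomp X (gcomp Y h g) f = gcomp X h (gcomp X g f)"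
  by (auto simp: gcomp_def compose_def graph_maps_def restrict_def fun_eq_iff)

lemma gcomp_gid:
  assumes "f \<in> graph_maps X Y"
  shows "gcomp X (gid Y) f = f" "gcomp X f (gid X) = f"
  using assms
  by (auto simp: gcomp_def gid_def graph_maps_def compose_def fun_eq_iff prod_eq_iff
      PiE_iff extensional_def)

lemma automorphisms_graph_map: "f \<in> automorphisms X \<Longrightarrow> f \<in> graph_maps X X"
  by (simp add: automorphisms_def)

lemma automorphismE:
  assumes "f \<in> automorphisms X"
  obtains h where "h \<in> automorphisms X" "gcomp X f h = gid X" "gcomp X h f = gid X"
  using assms by (auto simp: automorphisms_def)

lemma gid_automorphism: "is_graph X \<Longrightarrow> gid X \<in> automorphisms X"
  using gid_graph_map gcomp_gid unfolding automorphisms_def by blast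

lemma gcomp_automorphism:
  assumes "is_graph X" "f \<in> automorphisms X" "g \<in> automorphisms X"
  shows "gcomp X g f \<in> automorphisms X"
proof -
  obtain f' g' where i: "f' \<in> automorphisms X" "gcomp X f f' = gid X" "gcomp X f' f = gid X"
    "g' \<in> automorphisms X" "gcomp X g g' = gid X" "gcomp X g' g = gid X"
    using assms automorphismE by metis
  have m: "f \<in> graph_maps X X" "g \<in> graph_maps X X" "f' \<in> graph_maps X X" "g' \<in> graph_maps X X"
    using assms i automorphisms_graph_map by blast+
  have "gcomp X (gcomp X g f) (gcomp X f' g') = gid X"
    by (metis i(2,5) m gcomp_assoc gcomp_gid(1) gcomp_graph_map[OF assms(1)])
  moreover have "gcomp X (gcomp X f' g') (gcomp X g f) = gid X"
    by (metis i(3,6) m gcomp_assoc gcomp_gid(1) gcomp_graph_map[OF assms(1)])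
  ultimately show ?thesis
    using gcomp_graph_map[OF assms(1)] m unfolding automorphisms_def by blast
qed

lemma group_Aut:
  assumes "is_graph X"
  shows "group (Aut X)"
proof (rule groupI)
  fix f assume "f \<in> carrier (Aut X)"
  then show "\<exists>h \<in> carrier (Aut X). h \<otimes>\<^bsub>Aut X\<^esub> f = \<one>\<^bsub>Aut X\<^esub>"
    by (auto simp: Aut_def elim: automorphismE)
qed (auto simp: Aut_def assms gid_automorphism gcomp_automorphism gcomp_gid
      intro: gcomp_assoc dest: automorphisms_graph_map)

section \<open>The action of graph maps on homology classes\<close>

abbreviation push :: "('v, 'e, 'w, 'd) gmap \<Rightarrow> ('v, 'e) path \<Rightarrow> ('w, 'd) path" where
  "push f \<equiv> map_path (fst f) (snd f)"

declare path.map_sel [simp]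

lemma push_paths:
  assumes f: "f \<in> graph_maps X Y" and "\<alpha> \<in> paths X"
  shows "push f \<alpha> \<in> paths Y"
proof -
  have "walk Y (fst f x) (map (snd f) es) (fst f y)" if "walk X x es y" for x es y
    using that
  proof (induction es arbitrary: x)
    case (Cons e es)
    then show ?case using graph_mapD[OF f] by auto
  qed (simp add: graph_mapD[OF f])
  then show ?thesis using assms(2) by (simp add: paths_def)
qed

lemma push_pcat: "push f (pcat \<alpha> \<beta>) = pcat (push f \<alpha>) (push f \<beta>)"
  by (rule path.expand) simp

lemma push_gcomp:
  assumes "\<alpha> \<in> paths X"
  shows "push (gcomp X g f) \<alpha> = push g (push f \<alpha>)"
  using assms walk_edges[of X] walk_ends[of X]
  by (intro path.expand) (fastforce simp: paths_def)

lemma push_gid: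
  assumes "\<alpha> \<in> paths X"
  shows "push (gid X) \<alpha> = \<alpha>"
  using assms walk_edges[of X] walk_ends[of X]
  by (intro path.expand) (fastforce simp: paths_def intro: map_idI)

text \<open>A graph map commutes with inversion of edges and sends loops to loops, so each kind of move
  is carried to a move of the same kind.\<close>

lemma push_move:
  assumes f: "f \<in> graph_maps X Y" and "move X \<alpha> \<beta>"
  shows "move Y (push f \<alpha>) (push f \<beta>)"
proof -
  have P: "push f \<alpha> \<in> paths Y" "push f \<beta> \<in> paths Y"
    using move_paths[OF assms(2)] push_paths[OF f] by auto
  have inv: "snd f (einv X e) = einv Y (snd f e)"
    if "Path x (as @ [e, einv X e] @ bs) y \<in> paths X" for x as e bs y
    using that graph_mapD(5)[OF f] by (auto simp: paths_def walk_append)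
  from assms(2) show ?thesis
  proof cases
    case (introduce x as bs y e)
    then show ?thesis
      using P move.introduce[of _ "map (snd f) as" "map (snd f) bs" _ Y "snd f e"] inv by simp
  next
    case (delete x as bs y e)
    then show ?thesis
      using P move.delete[of _ "map (snd f) as" "map (snd f) bs" _ Y "snd f e"] inv by simp
  next
    case (swap x as ls ms bs y v)
    then show ?thesis
      using P push_paths[OF f swap(5)] push_paths[OF f swap(6)]
        move.swap[of _ "map (snd f) as" "map (snd f) ls" "map (snd f) ms" "map (snd f) bs"]
      by simp
  qed
qed

lemma push_homologous:
  assumes "f \<in> graph_maps X Y" "homologous X \<alpha> \<beta>"
  shows "homologous Y (push f \<alpha>) (push f \<beta>)"
proof -
  have "(move X)\<^sup>*\<^sup>* \<alpha> \<beta>" using assms(2) by (simp add: homologous_def)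
  then have "(move Y)\<^sup>*\<^sup>* (push f \<alpha>) (push f \<beta>)"
    by induction (auto dest: push_move[OF assms(1)] intro: rtranclp.rtrancl_into_rtrancl)
  then show ?thesis using assms(2) push_paths[OF assms(1)] by (simp add: homologous_def)
qed

text \<open>The map on homology classes induced by a graph map. As for composition of classes, the
  union runs over representatives that all give the same class.\<close>

definition hpush ::
  "('w, 'd) sgraph \<Rightarrow> ('v, 'e, 'w, 'd) gmap \<Rightarrow> ('v, 'e) path set \<Rightarrow> ('w, 'd) path set" where
  "hpush Y f A = (\<Union>\<alpha> \<in> A. hcls Y (push f \<alpha>))"

lemma hpush_hcls:
  assumes "f \<in> graph_maps X Y" "\<alpha> \<in> paths X"
  shows "hpush Y f (hcls X \<alpha>) = hcls Y (push f \<alpha>)"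
proof -
  have "hcls Y (push f \<alpha>') = hcls Y (push f \<alpha>)" if "\<alpha>' \<in> hcls X \<alpha>" for \<alpha>'
    using that hcls_eqI[OF push_homologous[OF assms(1)]] by (auto simp: hcls_def)
  moreover have "\<alpha> \<in> hcls X \<alpha>" using assms(2) homologous_refl by (simp add: hcls_def)
  ultimately show ?thesis unfolding hpush_def by blast
qed

section \<open>Lifts to the maximal abelian cover\<close>

lemma cover_sel [simp]:
  "verts (cover X x0) = atoms X x0"
  "(A, e) \<in> edges (cover X x0) \<longleftrightarrow> A \<in> atoms X x0 \<and> e \<in> edges X \<and> src X e = hterm A"
  "src (cover X x0) p = fst p"
  "tgt (cover X x0) p = extend X (fst p) (snd p)"
  "einv (cover X x0) p = (extend X (fst p) (snd p), einv X (snd p))"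
  by (simp_all add: cover_def split: prod.splits)

lemma cover_map_apply [simp]:
  "A \<in> atoms X x0 \<Longrightarrow> fst (cover_map X x0) A = hterm A"
  "p \<in> edges (cover X x0) \<Longrightarrow> snd (cover_map X x0) p = snd p"
  by (simp_all add: cover_map_def)

text \<open>The class \<open>B\<close> joins \<open>x0\<close> to its image under \<open>f\<close>; it brings the image classes, which start at
  that image, back to classes starting at \<open>x0\<close>.\<close>

definition lift ::
  "('v, 'e) sgraph \<Rightarrow> 'v \<Rightarrow> ('v, 'e, 'v, 'e) gmap \<Rightarrow> ('v, 'e) path set \<Rightarrow>
    ('v, 'e) cover_automorphism" where
  "lift X x0 f B = ((\<lambda>A \<in> verts (cover X x0). hcomp X B (hpush X f A)),
                    (\<lambda>(A, e) \<in> edges (cover X x0). (hcomp X B (hpush X f A), snd f e)))"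

lemma lift_apply:
  "A \<in> atoms X x0 \<Longrightarrow> fst (lift X x0 f B) A = hcomp X B (hpush X f A)"
  "p \<in> edges (cover X x0) \<Longrightarrow> snd (lift X x0 f B) p = (hcomp X B (hpush X f (fst p)), snd f (snd p))"
  by (simp_all add: lift_def split: prod.splits)

lemma lift_hcls:
  assumes "f \<in> graph_maps X X" "\<beta> \<in> paths X" "terminus \<beta> = fst f x0" "\<alpha> \<in> paths X" "origin \<alpha> = x0"
  shows "hcomp X (hcls X \<beta>) (hpush X f (hcls X \<alpha>)) = hcls X (pcat \<beta> (push f \<alpha>))"
  using assms by (simp add: hpush_hcls hcomp_hcls push_paths)

lemma lift_atom:
  assumes "f \<in> graph_maps X X" "B \<in> atoms X x0" "hterm B = fst f x0" "A \<in> atoms X x0"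
  shows "hcomp X B (hpush X f A) \<in> atoms X x0"
    and "hterm (hcomp X B (hpush X f A)) = fst f (hterm A)"
proof -
  obtain \<alpha> \<beta> where r: "A = hcls X \<alpha>" "\<alpha> \<in> paths X" "origin \<alpha> = x0" "hterm A = terminus \<alpha>"
    "B = hcls X \<beta>" "\<beta> \<in> paths X" "origin \<beta> = x0" "hterm B = terminus \<beta>"
    using assms atomE by metis
  have P: "pcat \<beta> (push f \<alpha>) \<in> paths X" using r assms by (simp add: pcat_paths push_paths)
  have "hcomp X B (hpush X f A) = hcls X (pcat \<beta> (push f \<alpha>))"
    using lift_hcls[OF assms(1)] r assms(3) by simp
  then show "hcomp X B (hpush X f A) \<in> atoms X x0"
    "hterm (hcomp X B (hpush X f A)) = fst f (hterm A)"
    using hcls_atom[OF P] hterm_hcls[OF P] r by simp_all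
qed

text \<open>Lifts respect targets: appending the image of \<open>e\<close> after prefixing by \<open>B\<close> is the same as
  prefixing after appending, by associativity of concatenation.\<close>

lemma lift_extend:
  assumes "is_graph X" "f \<in> graph_maps X X" "B \<in> atoms X x0" "hterm B = fst f x0"
    "(A, e) \<in> edges (cover X x0)"
  shows "hcomp X B (hpush X f (extend X A e)) = extend X (hcomp X B (hpush X f A)) (snd f e)"
proof -
  obtain \<alpha> \<beta> where r: "A = hcls X \<alpha>" "\<alpha> \<in> paths X" "origin \<alpha> = x0" "hterm A = terminus \<alpha>"
    "B = hcls X \<beta>" "\<beta> \<in> paths X" "origin \<beta> = x0" "hterm B = terminus \<beta>"
    using assms atomE by (metis cover_sel(2))
  have e: "e \<in> edges X" "src X e = terminus \<alpha>" using assms(5) r by auto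
  let ?\<epsilon> = "Path (src X e) [e] (tgt X e)"
  have \<epsilon>: "?\<epsilon> \<in> paths X" using e assms(1) by (auto simp: paths_def is_graph_def)
  have f\<epsilon>: "push f ?\<epsilon> = Path (src X (snd f e)) [snd f e] (tgt X (snd f e))"
    using graph_mapD[OF assms(2)] e by simp
  have t: "terminus \<beta> = fst f (origin \<alpha>)" using assms(4) r by simp
  have "hcomp X B (hpush X f (extend X A e)) = hcls X (pcat \<beta> (push f (pcat \<alpha> ?\<epsilon>)))"
    using r e t \<epsilon> lift_hcls[OF assms(2), of \<beta> x0 "pcat \<alpha> ?\<epsilon>"]
    by (simp add: extend_def hcomp_hcls pcat_paths)
  also have "\<dots> = hcls X (pcat (pcat \<beta> (push f \<alpha>)) (push f ?\<epsilon>))"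
    by (simp only: push_pcat pcat_assoc)
  also have "\<dots> = hcomp X (hcls X (pcat \<beta> (push f \<alpha>))) (hcls X (push f ?\<epsilon>))"
    using r e t push_paths[OF assms(2)] push_paths[OF assms(2) \<epsilon>]
    by (intro hcomp_hcls[symmetric] pcat_paths) simp_all
  also have "\<dots> = extend X (hcomp X B (hpush X f A)) (snd f e)"
    using lift_hcls[OF assms(2), of \<beta> x0 \<alpha>] r t unfolding extend_def f\<epsilon> by simp
  finally show ?thesis .
qed

lemma lift_graph_map:
  assumes "is_graph X" "f \<in> graph_maps X X" "B \<in> atoms X x0" "hterm B = fst f x0"
  shows "lift X x0 f B \<in> graph_maps (cover X x0) (cover X x0)"
proof -
  note la = lift_atom[OF assms(2-4)] and le = lift_extend[OF assms]
  note gm = graph_mapD[OF assms(2)]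
  have c: "extend X A e \<in> atoms X x0" "(extend X A e, einv X e) \<in> edges (cover X x0)"
    if "(A, e) \<in> edges (cover X x0)" for A e
    using is_graph_cover[OF assms(1), of x0] that unfolding is_graph_def by fastforce+
  have "fst (lift X x0 f B) \<in> verts (cover X x0) \<rightarrow>\<^sub>E verts (cover X x0)"
    using la(1) by (auto simp: lift_def)
  moreover have "snd (lift X x0 f B) \<in> edges (cover X x0) \<rightarrow>\<^sub>E edges (cover X x0)"
    using la gm by (auto simp: lift_def)
  moreover have "fst (snd (lift X x0 f B) p) = fst (lift X x0 f B) (fst p) \<and>
      extend X (fst (snd (lift X x0 f B) p)) (snd (snd (lift X x0 f B) p))
        = fst (lift X x0 f B) (extend X (fst p) (snd p)) \<and>
      (extend X (fst (snd (lift X x0 f B) p)) (snd (snd (lift X x0 f B) p)),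
        einv X (snd (snd (lift X x0 f B) p)))
        = snd (lift X x0 f B) (extend X (fst p) (snd p), einv X (snd p))"
    if "p \<in> edges (cover X x0)" for p
    using that c[of "fst p" "snd p"] le[of "fst p" "snd p"] gm
    by (cases p) (simp add: lift_apply)
  ultimately show ?thesis unfolding graph_maps_def mem_Collect_eq cover_sel by blast
qed

text \<open>Covering is a condition on atoms and edges of the cover. For a graph map of the cover the
  values of the covering map can be written out (\<open>covers_apply\<close>); for other \<open>g\<close> they may be
  undefined.\<close>

lemma covers_iff:
  "covers X x0 g f \<longleftrightarrow>
     (\<forall>A \<in> atoms X x0. fst (cover_map X x0) (fst g A) = fst f (hterm A)) \<and>
     (\<forall>p \<in> edges (cover X x0). snd (cover_map X x0) (snd g p) = snd f (snd p))"
  by (auto simp: covers_def gcomp_def compose_def cover_map_def fun_eq_iff restrict_def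
      simp del: cover_sel(2))

lemma covers_apply:
  assumes "g \<in> graph_maps (cover X x0) (cover X x0)"
  shows "covers X x0 g f \<longleftrightarrow>
     (\<forall>A \<in> atoms X x0. hterm (fst g A) = fst f (hterm A)) \<and>
     (\<forall>p \<in> edges (cover X x0). snd (snd g p) = snd f (snd p))"
  using graph_mapD(1,2)[OF assms] by (simp add: covers_iff)

lemma lift_covers:
  assumes "is_graph X" "f \<in> graph_maps X X" "B \<in> atoms X x0" "hterm B = fst f x0"
  shows "covers X x0 (lift X x0 f B) f"
  using lift_atom(2)[OF assms(2-4)]
  by (simp add: covers_apply[OF lift_graph_map[OF assms]] lift_apply)

text \<open>The composition law \<open>B \<cdot> f\<^sub>* (B' \<cdot> f'\<^sub>* A) = (B \<cdot> f\<^sub>* B') \<cdot> (f \<circ> f')\<^sub>* A\<close> of a semidirect product,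
  except that \<open>B\<close> and \<open>B'\<close> are classes of paths rather than of loops.\<close>

lemma lift_gcomp:
  assumes "is_graph X" "f \<in> graph_maps X X" "B \<in> atoms X x0" "hterm B = fst f x0"
    and "f' \<in> graph_maps X X" "B' \<in> atoms X x0" "hterm B' = fst f' x0" and "x0 \<in> verts X"
  shows "gcomp (cover X x0) (lift X x0 f B) (lift X x0 f' B')
           = lift X x0 (gcomp X f f') (hcomp X B (hpush X f B'))"
proof -
  let ?B = "hcomp X B (hpush X f B')"
  have ff: "gcomp X f f' \<in> graph_maps X X" using assms gcomp_graph_map by blast
  have B: "?B \<in> atoms X x0" "hterm ?B = fst (gcomp X f f') x0"
    using lift_atom[OF assms(2-4,6)] assms(7,8) by simp_all
  have v: "hcomp X B (hpush X f (hcomp X B' (hpush X f' A))) = hcomp X ?B (hpush X (gcomp X f f') A)"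
    if A: "A \<in> atoms X x0" for A
  proof -
    obtain \<alpha> where a: "A = hcls X \<alpha>" "\<alpha> \<in> paths X" "origin \<alpha> = x0" using A by (rule atomE)
    obtain \<beta> where b: "B = hcls X \<beta>" "\<beta> \<in> paths X" "origin \<beta> = x0" "hterm B = terminus \<beta>"
      using assms(3) by (rule atomE)
    obtain \<beta>' where b': "B' = hcls X \<beta>'" "\<beta>' \<in> paths X" "origin \<beta>' = x0" "hterm B' = terminus \<beta>'"
      using assms(6) by (rule atomE)
    show ?thesis
      using a b b' assms ff
      by (simp add: hpush_hcls hcomp_hcls push_paths pcat_paths push_pcat pcat_assoc push_gcomp)
  qed
  note l = lift_graph_map[OF assms(1-4)] lift_graph_map[OF assms(1,5-7)]
  show ?thesis
  proof (rule graph_map_eqI[OF gcomp_graph_map[OF is_graph_cover[OF assms(1)] l(2,1)]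
        lift_graph_map[OF assms(1) ff B]])
    fix A assume "A \<in> verts (cover X x0)"
    then show "fst (gcomp (cover X x0) (lift X x0 f B) (lift X x0 f' B')) A
        = fst (lift X x0 (gcomp X f f') ?B) A"
      using v lift_atom(1)[OF assms(5-7)] by (simp add: lift_apply)
  next
    fix p assume p: "p \<in> edges (cover X x0)"
    then have "fst p \<in> atoms X x0" "snd p \<in> edges X" by (cases p; simp)+
    then show "snd (gcomp (cover X x0) (lift X x0 f B) (lift X x0 f' B')) p
        = snd (lift X x0 (gcomp X f f') ?B) p"
      using v p graph_mapD(2)[OF l(2) p] by (simp add: lift_apply)
  qed
qed

lemma lift_gid:
  assumes "is_graph X" "C \<in> carrier (H1 X x0)"
  shows "lift X x0 (gid X) C = deck X x0 C"
proof -
  have "hpush X (gid X) A = A" if "A \<in> atoms X x0" for A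
    using that by (rule atomE) (simp add: hpush_hcls push_gid gid_graph_map assms(1))
  then show ?thesis by (auto simp: lift_def deck_def fun_eq_iff restrict_def)
qed

lemma deck_trivial:
  assumes "is_graph X" "x0 \<in> verts X"
  shows "deck X x0 (hcls X (Path x0 [] x0)) = gid (cover X x0)"
proof -
  have "hcomp X (hcls X (Path x0 [] x0)) A = A" if "A \<in> atoms X x0" for A
    using that by (rule atomE) (simp add: hcomp_hcls trivial_path assms(2))
  then show ?thesis by (auto simp: deck_def gid_def fun_eq_iff restrict_def)
qed

lemma H1_carrier: "C \<in> carrier (H1 X x0) \<longleftrightarrow> C \<in> atoms X x0 \<and> hterm C = x0"
  by (auto simp: H1_def atoms_def hterm_hcls)

text \<open>By the composition law, an inverse of \<open>lift f B\<close> must be of the form \<open>lift h B'\<close> with \<open>h\<close>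
  inverse to \<open>f\<close> and \<open>B \<cdot> f\<^sub>* B'\<close> trivial, which forces \<open>B'\<close> to be the image under \<open>h\<close> of the
  reverse of \<open>B\<close>.\<close>

lemma lift_automorphism:
  assumes "is_graph X" "x0 \<in> verts X" "f \<in> automorphisms X" "B \<in> atoms X x0" "hterm B = fst f x0"
  shows "lift X x0 f B \<in> automorphisms (cover X x0)"
proof -
  obtain h where h: "h \<in> automorphisms X" "gcomp X f h = gid X" "gcomp X h f = gid X"
    using assms(3) by (rule automorphismE)
  obtain \<beta> where b: "B = hcls X \<beta>" "\<beta> \<in> paths X" "origin \<beta> = x0" "hterm B = terminus \<beta>"
    using assms(4) by (rule atomE)
  have m: "f \<in> graph_maps X X" "h \<in> graph_maps X X"
    using assms(3) h(1) automorphisms_graph_map by blast+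
  have hf: "fst h (fst f x0) = x0" using arg_cong[OF h(3), of "\<lambda>k. fst k x0"] assms(2) by simp
  let ?\<beta> = "preverse X \<beta>"
  let ?B' = "hcls X (push h ?\<beta>)"
  have r: "?\<beta> \<in> paths X" "push h ?\<beta> \<in> paths X"
    using preverse_paths[OF assms(1) b(2)] push_paths[OF m(2)] by auto
  have B': "?B' \<in> atoms X x0" "hterm ?B' = fst h x0"
    using r b assms(5) hf by (auto simp: hterm_hcls intro!: hcls_atom)
  let ?T = "hcls X (Path x0 [] x0)"
  have T: "?T \<in> carrier (H1 X x0)"
    using trivial_path[OF assms(2)] by (auto simp: H1_carrier hterm_hcls intro!: hcls_atom)
  \<comment> \<open>Here \<open>f\<^sub>* (h\<^sub>* B\<inverse>) = B\<inverse>\<close>, so the class of \<open>lift f B \<circ> lift h ?B'\<close> is \<open>B \<cdot> B\<inverse>\<close>.\<close>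
  have "push f (push h ?\<beta>) = ?\<beta>"
    using push_gcomp[OF r(1), of f h] push_gid[OF r(1)] h(2) by simp
  then have "hcomp X B (hpush X f ?B') = hcls X (pcat \<beta> ?\<beta>)"
    using b r m by (simp add: hpush_hcls hcomp_hcls)
  also have "\<dots> = ?T" using hcls_eqI[OF pcat_preverse[OF assms(1) b(2)]] b by simp
  finally have 1: "gcomp (cover X x0) (lift X x0 f B) (lift X x0 h ?B') = gid (cover X x0)"
    using lift_gcomp[OF assms(1) m(1) assms(4,5) m(2) B' assms(2)] h(2)
      lift_gid[OF assms(1) T] deck_trivial[OF assms(1,2)] by simp
  \<comment> \<open>In the other order the class is \<open>h\<^sub>* (B\<inverse> \<cdot> B)\<close>.\<close>
  have "hcomp X ?B' (hpush X h B) = hcls X (push h (pcat ?\<beta> \<beta>))"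
    using b r m by (simp add: hpush_hcls hcomp_hcls push_paths push_pcat)
  also have "\<dots> = ?T"
    using hcls_eqI[OF push_homologous[OF m(2) preverse_pcat[OF assms(1) b(2)]]] b assms(5) hf
    by simp
  finally have 2: "gcomp (cover X x0) (lift X x0 h ?B') (lift X x0 f B) = gid (cover X x0)"
    using lift_gcomp[OF assms(1) m(2) B' m(1) assms(4,5,2)] h(3)
      lift_gid[OF assms(1) T] deck_trivial[OF assms(1,2)] by simp
  show ?thesis
    using 1 2 lift_graph_map[OF assms(1) m(1) assms(4,5)] lift_graph_map[OF assms(1) m(2) B']
    unfolding automorphisms_def by blast
qed

text \<open>Unique path lifting: \<open>g\<close> is determined by \<open>f\<close> and the image of the trivial atom. Along a
  path, the edge of the cover leaving a given atom over a given edge is unique, so the values of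
  \<open>g\<close> at successive atoms are forced, and \<open>lift f B\<close> obeys the same recursion.\<close>

lemma covers_is_lift:
  assumes "is_graph X" "x0 \<in> verts X" "f \<in> graph_maps X X"
    and g: "g \<in> graph_maps (cover X x0) (cover X x0)" "covers X x0 g f"
  defines "B \<equiv> fst g (hcls X (Path x0 [] x0))"
  shows "B \<in> atoms X x0" "hterm B = fst f x0" "g = lift X x0 f B"
proof -
  let ?t = "Path x0 [] x0"
  have t: "?t \<in> paths X" "hcls X ?t \<in> atoms X x0" "hterm (hcls X ?t) = x0"
    using trivial_path[OF assms(2)] by (auto simp: hterm_hcls intro: hcls_atom)
  have cv: "\<And>A. A \<in> atoms X x0 \<Longrightarrow> hterm (fst g A) = fst f (hterm A)"
    "\<And>p. p \<in> edges (cover X x0) \<Longrightarrow> snd (snd g p) = snd f (snd p)"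
    using g(2) unfolding covers_apply[OF g(1)] by blast+
  show B: "B \<in> atoms X x0" "hterm B = fst f x0"
    using graph_mapD(1)[OF g(1)] cv(1) t unfolding B_def by simp_all
  have v: "fst g (hcls X (Path x0 es y)) = hcomp X B (hpush X f (hcls X (Path x0 es y)))"
    if "Path x0 es y \<in> paths X" for es y
    using that
  proof (induction es arbitrary: y rule: rev_induct)
    case Nil
    then have y: "y = x0" by (simp add: paths_def)
    obtain \<beta> where b: "B = hcls X \<beta>" "\<beta> \<in> paths X" "hterm B = terminus \<beta>"
      using B(1) by (rule atomE)
    then have "hcomp X B (hpush X f (hcls X ?t)) = B"
      using lift_hcls[OF assms(3) b(2), of x0 ?t] B(2) t(1) by simp
    then show ?case by (simp add: y B_def)
  next
    case (snoc e es)
    let ?A = "hcls X (Path x0 es (src X e))"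
    have w: "Path x0 es (src X e) \<in> paths X" "e \<in> edges X" "tgt X e = y"
      using snoc.prems by (auto simp: paths_def walk_append)
    have p: "(?A, e) \<in> edges (cover X x0)"
      using w by (simp add: hcls_atom hterm_hcls)
    have x: "hcls X (Path x0 (es @ [e]) y) = extend X ?A e"
      using extend_hcls(1)[OF assms(1) w(1,2) refl] w(3) by simp
    have "fst g (extend X ?A e) = extend X (fst (snd g (?A, e))) (snd (snd g (?A, e)))"
      using graph_mapD(4)[OF g(1) p] by simp
    also have "\<dots> = extend X (hcomp X B (hpush X f ?A)) (snd f e)"
      using graph_mapD(3)[OF g(1) p] cv(2)[OF p] snoc.IH[OF w(1)] by simp
    also have "\<dots> = hcomp X B (hpush X f (extend X ?A e))"
      using lift_extend[OF assms(1,3) B p] by simp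
    finally show ?case by (simp add: x)
  qed
  have v': "fst g A = hcomp X B (hpush X f A)" if A: "A \<in> atoms X x0" for A
  proof -
    obtain \<alpha> where "A = hcls X \<alpha>" "\<alpha> \<in> paths X" "origin \<alpha> = x0" using A by (rule atomE)
    then show ?thesis using v[of "word \<alpha>" "terminus \<alpha>"] by (cases \<alpha>) simp
  qed
  show "g = lift X x0 f B"
  proof (rule graph_map_eqI[OF g(1) lift_graph_map[OF assms(1,3) B]])
    fix A assume "A \<in> verts (cover X x0)"
    then show "fst g A = fst (lift X x0 f B) A" using v' by (simp add: lift_apply)
  next
    fix p assume p: "p \<in> edges (cover X x0)"
    then have "fst p \<in> atoms X x0" by (cases p) simp
    then show "snd g p = snd (lift X x0 f B) p"
      using v' cv(2)[OF p] graph_mapD(3)[OF g(1) p] p by (simp add: lift_apply prod_eq_iff)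
  qed
qed

section \<open>The exact sequence\<close>

lemma covers_gcomp:
  assumes "is_graph X" "g \<in> graph_maps (cover X x0) (cover X x0)"
    and "g' \<in> graph_maps (cover X x0) (cover X x0)"
    and "covers X x0 g f" "covers X x0 g' f'"
  shows "covers X x0 (gcomp (cover X x0) g g') (gcomp X f f')"
proof -
  have q: "cover_map X x0 \<in> graph_maps (cover X x0) X" by (rule cover_map_graph_map[OF assms(1)])
  have "hterm A \<in> verts X" if "A \<in> atoms X x0" for A
    using graph_mapD(1)[OF q, of A] that by simp
  moreover have "snd p \<in> edges X" if "p \<in> edges (cover X x0)" for p
    using that by (cases p) simp
  ultimately show ?thesis
    using assms(4,5) graph_mapD(1,2)[OF assms(3)]
    by (simp add: covers_apply[OF gcomp_graph_map[OF is_graph_cover[OF assms(1)] assms(3,2)]]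
        covers_apply[OF assms(2)] covers_apply[OF assms(3)])
qed

lemma Cov_carrier:
  "g \<in> carrier (Cov X x0) \<longleftrightarrow>
    g \<in> automorphisms (cover X x0) \<and> (\<exists>f \<in> automorphisms X. covers X x0 g f)"
  by (simp add: Cov_def)

lemma Cov_simps [simp]:
  "monoid.mult (Cov X x0) = gcomp (cover X x0)" "one (Cov X x0) = gid (cover X x0)"
  by (simp_all add: Cov_def Aut_def)

lemma Aut_simps [simp]:
  "carrier (Aut X) = automorphisms X" "monoid.mult (Aut X) = gcomp X" "one (Aut X) = gid X"
  by (simp_all add: Aut_def)

lemma covers_gid: "covers X x0 (gid (cover X x0)) (gid X)" if "is_graph X"
  using cover_map_graph_map[OF that, of x0] gcomp_gid by (metis covers_def)

text \<open>From \<open>f \<circ> q = q \<circ> g\<close> one gets \<open>f \<circ> q \<circ> h = q \<circ> g \<circ> h = q\<close>, and composing with \<open>k\<close> on the left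
  gives \<open>q \<circ> h = k \<circ> q\<close>.\<close>

lemma covers_inverse:
  assumes "is_graph X" "g \<in> graph_maps (cover X x0) (cover X x0)"
    "h \<in> graph_maps (cover X x0) (cover X x0)" "gcomp (cover X x0) g h = gid (cover X x0)"
    and "f \<in> graph_maps X X" "k \<in> graph_maps X X" "gcomp X k f = gid X" "covers X x0 g f"
  shows "covers X x0 h k"
proof -
  let ?C = "cover X x0" and ?q = "cover_map X x0"
  have q: "?q \<in> graph_maps ?C X" by (rule cover_map_graph_map[OF assms(1)])
  have C: "is_graph ?C" by (rule is_graph_cover[OF assms(1)])
  have qh: "gcomp ?C ?q h \<in> graph_maps ?C X" using gcomp_graph_map C assms(3) q by blast
  have "gcomp ?C f (gcomp ?C ?q h) = gcomp ?C (gcomp ?C f ?q) h"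
    using gcomp_assoc[OF assms(3)] by metis
  also have "\<dots> = gcomp ?C (gcomp ?C ?q g) h" using assms(8) by (simp add: covers_def)
  also have "\<dots> = ?q" using gcomp_assoc[OF assms(3)] assms(4) gcomp_gid(2)[OF q] by metis
  finally have "gcomp ?C k ?q = gcomp ?C k (gcomp ?C f (gcomp ?C ?q h))" by simp
  also have "\<dots> = gcomp ?C ?q h"
    using gcomp_assoc[OF qh, of k f] assms(7) gcomp_gid(1)[OF qh] by metis
  finally show ?thesis by (simp add: covers_def)
qed

lemma group_Cov:
  assumes "is_graph X"
  shows "group (Cov X x0)"
proof -
  let ?C = "cover X x0"
  have C: "is_graph ?C" by (rule is_graph_cover[OF assms])
  show ?thesis
  proof (rule groupI)
    fix g g' assume "g \<in> carrier (Cov X x0)" "g' \<in> carrier (Cov X x0)"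
    then obtain f f' where
      g: "g \<in> automorphisms ?C" "f \<in> automorphisms X" "covers X x0 g f" and
      g': "g' \<in> automorphisms ?C" "f' \<in> automorphisms X" "covers X x0 g' f'"
      unfolding Cov_carrier by blast
    have "covers X x0 (gcomp ?C g g') (gcomp X f f')"
      using g g' by (intro covers_gcomp[OF assms] automorphisms_graph_map)
    then show "g \<otimes>\<^bsub>Cov X x0\<^esub> g' \<in> carrier (Cov X x0)"
      using gcomp_automorphism[OF C g'(1) g(1)] gcomp_automorphism[OF assms g'(2) g(2)]
      unfolding Cov_carrier Cov_simps by blast
  next
    show "\<one>\<^bsub>Cov X x0\<^esub> \<in> carrier (Cov X x0)"
      using gid_automorphism[OF C] gid_automorphism[OF assms] covers_gid[OF assms]
      unfolding Cov_carrier Cov_simps by blast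
  next
    fix g assume g: "g \<in> carrier (Cov X x0)"
    then obtain f where f: "f \<in> automorphisms X" "covers X x0 g f" by (auto simp: Cov_carrier)
    obtain k where k: "k \<in> automorphisms X" "gcomp X k f = gid X"
      using f(1) by (rule automorphismE)
    obtain h where h: "h \<in> automorphisms ?C" "gcomp ?C g h = gid ?C" "gcomp ?C h g = gid ?C"
      using g by (auto simp: Cov_carrier elim: automorphismE)
    have "g \<in> automorphisms ?C" using g by (simp add: Cov_carrier)
    then have "covers X x0 h k"
      using f k h by (intro covers_inverse[OF assms, of g x0 h f k] automorphisms_graph_map)
    then have "h \<in> carrier (Cov X x0)" using h(1) k(1) by (auto simp: Cov_carrier)
    then show "\<exists>h \<in> carrier (Cov X x0). h \<otimes>\<^bsub>Cov X x0\<^esub> g = \<one>\<^bsub>Cov X x0\<^esub>"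
      using h(3) unfolding Cov_simps by blast
  qed (auto simp: Cov_carrier gcomp_gid intro: gcomp_assoc dest: automorphisms_graph_map)
qed

lemma \<psi>_eqI:
  assumes "connected_graph X" "x0 \<in> verts X" "g \<in> carrier (Cov X x0)"
    "f \<in> automorphisms X" "covers X x0 g f"
  shows "\<psi> X x0 g = f"
  using covers_unique[OF assms(1-3)] assms(4,5) unfolding \<psi>_def
  by (metis (mono_tags, lifting) the_equality)

lemma \<psi>_covers:
  assumes "connected_graph X" "x0 \<in> verts X" "g \<in> carrier (Cov X x0)"
  shows "\<psi> X x0 g \<in> automorphisms X" "covers X x0 g (\<psi> X x0 g)"
  using \<psi>_eqI[OF assms] assms(3) by (auto simp: Cov_carrier)

text \<open>Multiplicativity holds because \<open>\<psi> g \<circ> \<psi> g'\<close> is covered by \<open>g \<circ> g'\<close> and the covered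
  automorphism is unique. Surjectivity is the existence of lifts.\<close>

lemma \<psi>_epi:
  assumes "connected_graph X" "x0 \<in> verts X"
  shows "\<psi> X x0 \<in> epi (Cov X x0) (Aut X)"
proof -
  have X: "is_graph X" using assms(1) by (simp add: connected_graph_def)
  interpret C: group "Cov X x0" by (rule group_Cov[OF X])
  note \<psi> = \<psi>_covers[OF assms]
  have "\<psi> X x0 (gcomp (cover X x0) g g') = gcomp X (\<psi> X x0 g) (\<psi> X x0 g')"
    if g: "g \<in> carrier (Cov X x0)" "g' \<in> carrier (Cov X x0)" for g g'
  proof (rule \<psi>_eqI[OF assms])
    show "gcomp (cover X x0) g g' \<in> carrier (Cov X x0)" using C.m_closed[OF g] by simp
    show "gcomp X (\<psi> X x0 g) (\<psi> X x0 g') \<in> automorphisms X"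
      using gcomp_automorphism[OF X] \<psi>(1) g by blast
    show "covers X x0 (gcomp (cover X x0) g g') (gcomp X (\<psi> X x0 g) (\<psi> X x0 g'))"
      using g by (intro covers_gcomp[OF X] \<psi>(2) automorphisms_graph_map) (simp_all add: Cov_carrier)
  qed
  then have hom: "\<psi> X x0 \<in> hom (Cov X x0) (Aut X)"
    using \<psi>(1) by (auto simp: hom_def)
  have "f \<in> \<psi> X x0 ` carrier (Cov X x0)" if f: "f \<in> automorphisms X" for f
  proof -
    have m: "f \<in> graph_maps X X" by (rule automorphisms_graph_map[OF f])
    have "fst f x0 \<in> verts X" using graph_mapD(1)[OF m assms(2)] .
    then obtain \<beta> where b: "\<beta> \<in> paths X" "origin \<beta> = x0" "terminus \<beta> = fst f x0"
      using assms by (auto simp: connected_graph_def)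
    then have B: "hcls X \<beta> \<in> atoms X x0" "hterm (hcls X \<beta>) = fst f x0"
      by (simp_all add: hcls_atom hterm_hcls)
    have cv: "covers X x0 (lift X x0 f (hcls X \<beta>)) f" by (rule lift_covers[OF X m B])
    then have "lift X x0 f (hcls X \<beta>) \<in> carrier (Cov X x0)"
      using lift_automorphism[OF X assms(2) f B] f by (auto simp: Cov_carrier)
    then show ?thesis using \<psi>_eqI[OF assms _ f cv] by force
  qed
  then show ?thesis using hom \<psi>(1) by (auto simp: epi_def)
qed

lemma deck_Cov:
  assumes "is_graph X" "x0 \<in> verts X" "C \<in> carrier (H1 X x0)"
  shows "deck X x0 C \<in> carrier (Cov X x0)" "covers X x0 (deck X x0 C) (gid X)"
proof -
  have C: "C \<in> atoms X x0" "hterm C = fst (gid X) x0" using assms by (auto simp: H1_carrier)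
  show c: "covers X x0 (deck X x0 C) (gid X)"
    using lift_covers[OF assms(1) gid_graph_map[OF assms(1)] C] lift_gid[OF assms(1,3)] by simp
  show "deck X x0 C \<in> carrier (Cov X x0)"
    using c lift_automorphism[OF assms(1,2) gid_automorphism[OF assms(1)] C]
      lift_gid[OF assms(1,3)] gid_automorphism[OF assms(1)] by (auto simp: Cov_carrier)
qed

text \<open>The homomorphism law is the composition law for lifts of the identity. Evaluation at the
  trivial atom recovers \<open>C\<close> from its deck transformation, which gives injectivity.\<close>

lemma deck_mon:
  assumes "is_graph X" "x0 \<in> verts X"
  shows "deck X x0 \<in> mon (H1 X x0) (Cov X x0)"
proof -
  interpret H: group "H1 X x0" by (rule group_H1[OF assms])
  let ?t = "Path x0 [] x0"
  have i: "gid X \<in> graph_maps X X" by (rule gid_graph_map[OF assms(1)])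
  have "deck X x0 (hcomp X C D) = gcomp (cover X x0) (deck X x0 C) (deck X x0 D)"
    if CD: "C \<in> carrier (H1 X x0)" "D \<in> carrier (H1 X x0)" for C D
  proof -
    have "hpush X (gid X) D = D"
      using CD(2) unfolding H1_carrier
      by (auto elim!: atomE simp: hpush_hcls push_gid i)
    moreover have "hcomp X C D \<in> carrier (H1 X x0)"
      using H.m_closed[OF CD] by (simp add: H1_def)
    ultimately show ?thesis
      using lift_gcomp[OF assms(1) i _ _ i _ _ assms(2), of C D] CD lift_gid[OF assms(1)]
        gcomp_gid(1)[OF i] assms(2) by (simp add: H1_carrier)
  qed
  then have "deck X x0 \<in> hom (H1 X x0) (Cov X x0)"
    using deck_Cov(1)[OF assms] by (auto simp: hom_def H1_def)
  moreover have "inj_on (deck X x0) (carrier (H1 X x0))"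
  proof (rule inj_on_inverseI)
    fix C assume C: "C \<in> carrier (H1 X x0)"
    then obtain \<gamma> where "C = hcls X \<gamma>" "\<gamma> \<in> paths X" "terminus \<gamma> = x0" by (auto simp: H1_def)
    then have "hcomp X C (hcls X ?t) = C"
      using trivial_path[OF assms(2)] by (simp add: hcomp_hcls)
    then show "fst (deck X x0 C) (hcls X ?t) = C"
      using hcls_atom[OF trivial_path[OF assms(2)], of x0] by (simp add: deck_def)
  qed
  ultimately show ?thesis by (simp add: mon_def)
qed

text \<open>A covering symmetry in the kernel covers the identity, so by unique path lifting it is a lift
  of the identity; its class is the image of the trivial atom, which lies over \<open>x0\<close> and hence
  consists of loops.\<close>

lemma \<psi>_kernel:
  assumes "connected_graph X" "x0 \<in> verts X"
  shows "kernel (Cov X x0) (Aut X) (\<psi> X x0) = deck X x0 ` carrier (H1 X x0)"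
proof
  have X: "is_graph X" using assms(1) by (simp add: connected_graph_def)
  show "deck X x0 ` carrier (H1 X x0) \<subseteq> kernel (Cov X x0) (Aut X) (\<psi> X x0)"
    using deck_Cov[OF X assms(2)] by (simp add: kernel_def image_subset_iff
        \<psi>_eqI[OF assms _ gid_automorphism[OF X]])
  show "kernel (Cov X x0) (Aut X) (\<psi> X x0) \<subseteq> deck X x0 ` carrier (H1 X x0)"
  proof
    fix g assume "g \<in> kernel (Cov X x0) (Aut X) (\<psi> X x0)"
    then have g: "g \<in> carrier (Cov X x0)" "\<psi> X x0 g = gid X" by (auto simp: kernel_def)
    have c: "covers X x0 g (gid X)" using \<psi>_covers(2)[OF assms g(1)] g(2) by simp
    have m: "g \<in> graph_maps (cover X x0) (cover X x0)"
      using g(1) by (simp add: Cov_carrier automorphisms_graph_map)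
    let ?C = "fst g (hcls X (Path x0 [] x0))"
    note l = covers_is_lift[OF X assms(2) gid_graph_map[OF X] m c]
    have "?C \<in> carrier (H1 X x0)" using l(1,2) assms(2) by (simp add: H1_carrier)
    then show "g \<in> deck X x0 ` carrier (H1 X x0)"
      using l(3) lift_gid[OF X, of ?C x0] by (simp add: image_eqI[where x = ?C])
  qed
qed

theorem lemma9:
  fixes X :: "('v, 'e) sgraph" and x0 :: 'v
  assumes "connected_graph X" and "x0 \<in> verts X"
  shows "group (H1 X x0) \<and> group (Cov X x0) \<and> group (Aut X) \<and>
         \<psi> X x0 \<in> epi (Cov X x0) (Aut X) \<and>
         deck X x0 \<in> mon (H1 X x0) (Cov X x0) \<and>
         kernel (Cov X x0) (Aut X) (\<psi> X x0) = deck X x0 ` carrier (H1 X x0)"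
proof -
  have "is_graph X" using assms(1) by (simp add: connected_graph_def)
  then show ?thesis
    using assms by (intro conjI group_H1 group_Cov group_Aut \<psi>_epi deck_mon \<psi>_kernel)
qed

end
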